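(* Let $A\in\mathbb{R}^{n\times n}$ and $B\in\mathbb{R}^{n\times p}$ be constant matrices such that $(A,B)$ is controllable, and let $\Sigma_0,\Sigma_1\in\mathbb{R}^{n\times n}$ be symmetric with $\Sigma_0,\Sigma_1\succ 0$. Let $M:[0,1]\to\mathbb{R}^{n\times n}$ (symmetric-valued) and $\nu:[0,1]\to\mathbb{R}$ be of class $\mathcal{C}^{\max(n-2,0)}$ and such that $M(t)\succeq 0$ and $\nu(t)\ge 0$ on $[0,1]$. Then there exists $K\in\mathcal{C}^{0}$, $K:[0,1]\to\mathbb{R}^{p\times n}$, such that the solution of the matrix differential equation $$\dot{\Sigma} = \big(A + B K(t)\big) \Sigma + \Sigma \big(A + B K(t)\big)^{T} + M(t) + 2\nu(t) \Sigma$$ satisfies $\Sigma(t)\succ 0$ on $[0,1]$ with boundary conditions $\Sigma(0)=\Sigma_0$ and $\Sigma(1)=\Sigma_1$.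
   Context: $\mathcal{C}^k$ denotes the class of $k$-times continuously differentiable functions on $[0,1]$; $\succ$, $\succeq$ denote the Loewner order on symmetric matrices. $(A,B)$ is controllable if $\operatorname{rank}[B\ AB\ \cdots\ A^{n-1}B]=n$. *)

theory Defs
  imports "HOL-Analysis.Analysis"
begin

(* Powers with respect to the matrix product; the type-class power A ^ k
   on real^'n^'n is componentwise. *)
primrec mat_pow :: "real^'n^'n \<Rightarrow> nat \<Rightarrow> real^'n^'n" where
  "mat_pow A 0 = mat 1"
| "mat_pow A (Suc k) = A ** mat_pow A k"

(* The block matrix [B  AB  ...  A^(n-1) B].  The pair (k, j) indexes column j of the block
   A^e B, where to_nat_on UNIV enumerates the index type 'n bijectively by
   the exponents e = 0, ..., n-1. *)
definition controllability_matrix :: "real^'n^'n \<Rightarrow> real^'p^'n \<Rightarrow> real^('n \<times> 'p)^'n" where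
  "controllability_matrix A B =
    (\<chi> i. \<chi> kj. (mat_pow A (to_nat_on UNIV (fst kj)) ** B) $ i $ snd kj)"

definition controllable :: "real^'n^'n \<Rightarrow> real^'p^'n \<Rightarrow> bool" where
  "controllable A B \<longleftrightarrow> rank (controllability_matrix A B) = CARD('n)"

definition loewner_le :: "real^'n^'n \<Rightarrow> real^'n^'n \<Rightarrow> bool" (infix "\<preceq>\<^sub>L" 50) where
  "X \<preceq>\<^sub>L Y \<longleftrightarrow> transpose X = X \<and> transpose Y = Y \<and> (\<forall>v. v \<bullet> (X *v v) \<le> v \<bullet> (Y *v v))"

definition loewner_less :: "real^'n^'n \<Rightarrow> real^'n^'n \<Rightarrow> bool" (infix "\<prec>\<^sub>L" 50) where
  "X \<prec>\<^sub>L Y \<longleftrightarrow> transpose X = X \<and> transpose Y = Y \<and> (\<forall>v. v \<noteq> 0 \<longrightarrow> v \<bullet> (X *v v) < v \<bullet> (Y *v v))"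

(* Functions of class C^k on S.  Derivatives are taken within S, hence are one-sided at the
   endpoints of a compact interval. *)
primrec Ck_on :: "nat \<Rightarrow> real set \<Rightarrow> (real \<Rightarrow> 'a::real_normed_vector) \<Rightarrow> bool" where
  "Ck_on 0 S f \<longleftrightarrow> continuous_on S f"
| "Ck_on (Suc k) S f \<longleftrightarrow>
    (\<exists>f'. (\<forall>t\<in>S. (f has_vector_derivative f' t) (at t within S)) \<and> Ck_on k S f')"

definition solves_covariance_ode ::
  "real^'n^'n \<Rightarrow> real^'p^'n \<Rightarrow> (real \<Rightarrow> real^'n^'p) \<Rightarrow> (real \<Rightarrow> real^'n^'n) \<Rightarrow> (real \<Rightarrow> real) \<Rightarrow>
    (real \<Rightarrow> real^'n^'n) \<Rightarrow> bool" where
  "solves_covariance_ode A B K M \<nu> \<Sigma> \<longleftrightarrow>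
    (\<forall>t\<in>{0..1}.
      (\<Sigma> has_vector_derivative
        ((A + B ** K t) ** \<Sigma> t + \<Sigma> t ** transpose (A + B ** K t) + M t + (2 * \<nu> t) *\<^sub>R \<Sigma> t))
      (at t within {0..1}))"

end

theory Submission
  imports Defs
begin

text \<open>
  Let \<open>\<Phi> t = exp (\<integral>\<^sub>0\<^sup>t \<nu>) e\<^sup>t\<^sup>A\<close> and \<open>\<Psi> t = (\<Phi> t)\<^sup>-\<^sup>1\<close>. Writing \<open>\<Sigma> = \<Phi> S \<Phi>\<^sup>T\<close> absorbs both the drift
  and the growth term, and the equation becomes
  \<open>S' = N + C V + (C V)\<^sup>T\<close> with \<open>N = \<Psi> M \<Psi>\<^sup>T \<succeq> 0\<close>, \<open>C = \<Psi> B\<close> and \<open>V = K \<Sigma> \<Psi>\<^sup>T\<close>. As long as \<open>\<Sigma>\<close> stays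
  invertible, a continuous \<open>V\<close> yields the continuous gain \<open>K = V \<Phi>\<^sup>T \<Sigma>\<^sup>-\<^sup>1\<close>. So it suffices to steer \<open>S\<close>
  from \<open>S\<^sub>0 = \<Sigma>\<^sub>0\<close> to \<open>S\<^sub>1 = \<Psi> 1 \<Sigma>\<^sub>1 (\<Psi> 1)\<^sup>T\<close> with a continuous \<open>V\<close>, keeping it positive definite.

  The uncontrolled solution \<open>P t = S\<^sub>0 + \<integral>\<^sub>0\<^sup>t N\<close> is nondecreasing, hence positive definite.
  Let it run up to a time \<open>s < 1\<close> so late that the noise \<open>P 1 - P s\<close> still to come is smaller
  than the target: \<open>T = S\<^sub>1 - (P 1 - P s) \<succ> 0\<close>. On \<open>[s, 1]\<close> take a matrix path \<open>G\<close> from \<open>0\<close> to the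
  identity with \<open>G' = C W\<close>, and set
  \<open>S = (1 - G) (P s) (1 - G)\<^sup>T + G T G\<^sup>T + (P - P s)\<close>.
  The old covariance \<open>P s\<close> is steered to \<open>0\<close> while \<open>T\<close> is built up from \<open>0\<close>, and
  the new noise is left alone, so \<open>S 1 = S\<^sub>1\<close>. The three summands are
  positive semidefinite; since \<open>(1 - G)\<^sup>T v\<close> and \<open>G\<^sup>T v\<close> add up to \<open>v\<close>, at most one of them
  vanishes if \<open>v \<noteq> 0\<close>, and \<open>S\<close> is positive definite. The only derivative of \<open>S\<close> besides \<open>N\<close> comes from
  \<open>G\<close> and factors through \<open>C\<close>, as the equation demands. This is lemma \<open>driftless_steering\<close>.

  The path \<open>G\<close> exists because the Gramian of \<open>C\<close> over \<open>[s, 1]\<close> is invertible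
  (\<open>gramian_invertible\<close>), which is where controllability enters (\<open>controllable_excitation\<close>).
  Finally the equation is linear in \<open>\<Sigma>\<close>, so that its solution for this \<open>K\<close> is
  the constructed one (\<open>covariance_ode_unique\<close>).
\<close>

section \<open>Matrix calculus\<close>

lemma bounded_bilinear_matrix_mult:
  "bounded_bilinear ((**) :: real^'n^'m \<Rightarrow> real^'p^'n \<Rightarrow> real^'p^'m)"
proof -
  have "bilinear ((**) :: real^'n^'m \<Rightarrow> real^'p^'n \<Rightarrow> real^'p^'m)"
    by (auto simp: bilinear_def linear_iff matrix_add_ldistrib scalar_matrix_assoc matrix_scalar_ac
        matrix_matrix_mult_def vec_eq_iff sum.distrib sum_distrib_left algebra_simps)
  then show ?thesis
    by (simp add: bilinear_conv_bounded_bilinear)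
qed

lemma bounded_bilinear_matrix_vector_mult:
  "bounded_bilinear ((*v) :: real^'n^'m \<Rightarrow> real^'n \<Rightarrow> real^'m)"
proof -
  have "bilinear ((*v) :: real^'n^'m \<Rightarrow> real^'n \<Rightarrow> real^'m)"
    by (auto simp: bilinear_def linear_iff algebra_simps scaleR_matrix_vector_assoc)
  then show ?thesis
    by (simp add: bilinear_conv_bounded_bilinear)
qed

lemma bounded_linear_transpose: "bounded_linear (transpose :: real^'n^'m \<Rightarrow> real^'m^'n)"
  by (auto simp: linear_conv_bounded_linear[symmetric] linear_iff transpose_scalar
      transpose_def vec_eq_iff)

lemmas matrix_mult_linear_simps =
  bounded_bilinear.add_left[OF bounded_bilinear_matrix_mult]
  bounded_bilinear.add_right[OF bounded_bilinear_matrix_mult]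
  bounded_bilinear.diff_left[OF bounded_bilinear_matrix_mult]
  bounded_bilinear.diff_right[OF bounded_bilinear_matrix_mult]
  bounded_bilinear.minus_left[OF bounded_bilinear_matrix_mult]
  bounded_bilinear.minus_right[OF bounded_bilinear_matrix_mult]
  bounded_bilinear.scaleR_left[OF bounded_bilinear_matrix_mult]
  bounded_bilinear.scaleR_right[OF bounded_bilinear_matrix_mult]

lemmas matrix_mult_zero_simps =
  bounded_bilinear.zero_left[OF bounded_bilinear_matrix_mult]
  bounded_bilinear.zero_right[OF bounded_bilinear_matrix_mult]

lemmas transpose_linear_simps =
  linear_add[OF bounded_linear.linear[OF bounded_linear_transpose]]
  linear_diff[OF bounded_linear.linear[OF bounded_linear_transpose]]
  linear_0[OF bounded_linear.linear[OF bounded_linear_transpose]]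
  transpose_scalar

lemmas has_vector_derivative_matrix_mult =
  bounded_bilinear.has_vector_derivative[OF bounded_bilinear_matrix_mult]

lemmas has_vector_derivative_transpose =
  bounded_linear.has_vector_derivative[OF bounded_linear_transpose]

lemmas continuous_on_matrix_mult =
  bounded_bilinear.continuous_on[OF bounded_bilinear_matrix_mult]

lemmas continuous_on_transpose =
  bounded_linear.continuous_on[OF bounded_linear_transpose]

lemma has_vector_derivative_quadratic_form:
  fixes X :: "real \<Rightarrow> real^'n^'n"
  assumes "(X has_vector_derivative X') (at t within S)"
  shows "((\<lambda>t. v \<bullet> (X t *v v)) has_vector_derivative v \<bullet> (X' *v v)) (at t within S)"
proof -
  have "bounded_linear (\<lambda>X :: real^'n^'n. v \<bullet> (X *v v))"
    using bounded_linear_compose[OF bounded_linear_inner_right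
        bounded_bilinear.bounded_linear_left[OF bounded_bilinear_matrix_vector_mult]] .
  from bounded_linear.has_vector_derivative[OF this assms] show ?thesis .
qed

lemma matrix_inv_mult:
  assumes "invertible X"
  shows "X ** matrix_inv X = mat 1" and "matrix_inv X ** X = mat 1"
  using someI_ex[of "\<lambda>Y. X ** Y = mat 1 \<and> Y ** X = mat 1"] assms
  by (auto simp: invertible_def matrix_inv_def)

lemma continuous_on_det:
  fixes X :: "'a::topological_space \<Rightarrow> real^'n^'n"
  assumes "\<And>i j. continuous_on S (\<lambda>t. X t $ i $ j)"
  shows "continuous_on S (\<lambda>t. det (X t))"
  unfolding det_def by (intro continuous_intros assms)

lemma continuous_on_matrix_inv:
  fixes X :: "real \<Rightarrow> real^'n^'n"
  assumes cont: "continuous_on S X" and inv: "\<And>t. t \<in> S \<Longrightarrow> invertible (X t)"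
  shows "continuous_on S (\<lambda>t. matrix_inv (X t))"
proof -
  have det: "det (X t) \<noteq> 0" if "t \<in> S" for t
    using inv[OF that] by (simp add: invertible_det_nz)
  have cont_nth: "continuous_on S (\<lambda>t. X t $ i $ j)" for i j
    by (intro continuous_intros cont)
  \<comment> \<open>Column l of the inverse solves a linear system, so Cramer's rule gives its entries.\<close>
  have entry: "matrix_inv (X t) $ k $ l =
      det (\<chi> i j. if j = k then axis l 1 $ i else X t $ i $ j) / det (X t)" if "t \<in> S" for t k l
  proof -
    have "X t ** matrix_inv (X t) = mat 1"
      using inv[OF that] by (rule matrix_inv_mult)
    then have "X t *v (matrix_inv (X t) *v axis l 1) = axis l 1"
      by (simp add: matrix_vector_mul_assoc)
    then have "matrix_inv (X t) *v axis l 1 =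
        (\<chi> k. det (\<chi> i j. if j = k then axis l 1 $ i else X t $ i $ j) / det (X t))"
      using cramer[OF det[OF that]] by blast
    then show ?thesis
      by (simp add: matrix_vector_mul_component vec_eq_iff matrix_vector_mult_basis column_def)
  qed
  have "continuous_on S (\<lambda>t. det (\<chi> i j. if j = k then axis l 1 $ i else X t $ i $ j) / det (X t))"
    for k l
  proof (intro continuous_on_divide continuous_on_det cont_nth ballI det)
    show "continuous_on S (\<lambda>t. (\<chi> i j. if j = k then axis l 1 $ i else X t $ i $ j) $ i $ j)" for i j
      using cont_nth by (cases "j = k") auto
  qed
  then have "continuous_on S (\<lambda>t. \<chi> k l.
      det (\<chi> i j. if j = k then axis l 1 $ i else X t $ i $ j) / det (X t))"
    by (intro continuous_on_vec_lambda)
  then show ?thesis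
    by (rule continuous_on_eq) (simp add: vec_eq_iff entry)
qed

text \<open>
  A Gronwall argument: \<open>exp (- 2 C t) \<bar>f t\<bar>\<^sup>2\<close> is nonincreasing and starts at \<open>0\<close>. With
  \<open>C = 0\<close> this says that a function with zero derivative stays at \<open>0\<close>.
\<close>

lemma zero_if_derivative_norm_le:
  fixes f f' :: "real \<Rightarrow> 'a::real_inner"
  assumes der: "\<And>t. t \<in> {a..b} \<Longrightarrow> (f has_vector_derivative f' t) (at t within {a..b})"
    and bound: "\<And>t. t \<in> {a..b} \<Longrightarrow> norm (f' t) \<le> C * norm (f t)"
    and init: "f a = 0" and t: "t \<in> {a..b}"
  shows "f t = 0"
proof -
  define g where "g r = exp (- (2 * C) * r) * (f r \<bullet> f r)" for r
  have g_der: "(g has_vector_derivative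
      exp (- (2 * C) * r) * (2 * (f r \<bullet> f' r) - 2 * C * (f r \<bullet> f r))) (at r within {a..b})"
    if "r \<in> {a..b}" for r
  proof -
    have 1: "((\<lambda>r. f r \<bullet> f r) has_vector_derivative f r \<bullet> f' r + f' r \<bullet> f r) (at r within {a..b})"
      by (rule bounded_bilinear.has_vector_derivative[OF bounded_bilinear_inner der[OF that] der[OF that]])
    have 2: "((\<lambda>r. exp (- (2 * C) * r)) has_vector_derivative - (2 * C) * exp (- (2 * C) * r))
        (at r within {a..b})"
      unfolding has_real_derivative_iff_has_vector_derivative[symmetric]
      by (auto intro!: derivative_eq_intros)
    show ?thesis
      unfolding g_def
      by (rule has_vector_derivative_eq_rhs[OF has_vector_derivative_mult[OF 2 1]])
         (simp add: algebra_simps inner_commute)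
  qed
  have g_le: "exp (- (2 * C) * r) * (2 * (f r \<bullet> f' r) - 2 * C * (f r \<bullet> f r)) \<le> 0"
    if "r \<in> {a..b}" for r
  proof -
    have "f r \<bullet> f' r \<le> norm (f r) * norm (f' r)" by (rule norm_cauchy_schwarz)
    also have "\<dots> \<le> norm (f r) * (C * norm (f r))" by (intro mult_left_mono bound that) auto
    also have "\<dots> = C * (f r \<bullet> f r)" by (simp add: power2_norm_eq_inner[symmetric] power2_eq_square)
    finally show ?thesis by (simp add: mult_le_0_iff)
  qed
  have "((\<lambda>r. exp (- (2 * C) * r) * (2 * (f r \<bullet> f' r) - 2 * C * (f r \<bullet> f r)))
      has_integral (g t - g a)) {a..t}"
    using t by (intro fundamental_theorem_of_calculus
        has_vector_derivative_within_subset[OF g_der]) auto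
  then have "0 \<le> - (g t - g a)"
    by (rule has_integral_nonneg[OF has_integral_neg]) (use t g_le in force)
  then have "f t \<bullet> f t \<le> 0"
    using init by (simp add: g_def mult_le_0_iff)
  then show "f t = 0"
    using inner_gt_zero_iff[of "f t"] by linarith
qed

section \<open>Positive definite matrices\<close>

lemma posdef_iff:
  "0 \<prec>\<^sub>L X \<longleftrightarrow> transpose X = X \<and> (\<forall>v. v \<noteq> 0 \<longrightarrow> 0 < v \<bullet> (X *v v))"
  by (simp add: loewner_less_def transpose_linear_simps)

lemma psd_iff:
  "0 \<preceq>\<^sub>L X \<longleftrightarrow> transpose X = X \<and> (\<forall>v. 0 \<le> v \<bullet> (X *v v))"
  by (simp add: loewner_le_def transpose_linear_simps)

lemma quadratic_form_congruence:
  fixes X :: "real^'n^'m"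
  shows "v \<bullet> ((X ** Y ** transpose X) *v v) = (v v* X) \<bullet> (Y *v (v v* X))"
proof -
  have "(X ** Y ** transpose X) *v v = X *v (Y *v (v v* X))"
    by (simp flip: matrix_vector_mul_assoc)
  then show ?thesis by (simp add: dot_lmul_matrix)
qed

lemma transpose_congruence:
  fixes X :: "real^'n^'m"
  assumes "transpose Y = Y"
  shows "transpose (X ** Y ** transpose X) = X ** Y ** transpose X"
  using assms by (simp add: matrix_transpose_mul matrix_mul_assoc)

lemma posdef_congruence:
  fixes X Y Z :: "real^'n^'n"
  assumes "0 \<prec>\<^sub>L Y" and "X ** Z = mat 1"
  shows "0 \<prec>\<^sub>L X ** Y ** transpose X"
proof -
  have "v v* X \<noteq> 0" if "v \<noteq> 0" for v
  proof
    assume "v v* X = 0"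
    then have "v v* (X ** Z) = 0" by (simp flip: vector_matrix_mul_assoc)
    with that assms(2) show False by simp
  qed
  then show ?thesis
    using assms(1) by (auto simp: posdef_iff transpose_congruence quadratic_form_congruence)
qed

lemma psd_congruence: "0 \<preceq>\<^sub>L Y \<Longrightarrow> 0 \<preceq>\<^sub>L X ** Y ** transpose X"
  by (auto simp: psd_iff transpose_congruence quadratic_form_congruence)

lemma invertible_posdef:
  assumes "0 \<prec>\<^sub>L X" shows "invertible X"
proof -
  have "x = 0" if "X *v x = 0" for x
    using assms that by (force simp: posdef_iff)
  then show ?thesis
    using matrix_left_invertible_ker invertible_left_inverse by blast
qed

text \<open>
  By compactness of the unit sphere the form of \<open>X\<close> is bounded below by a positive multiple of
  \<open>\<bar>v\<bar>\<^sup>2\<close>, which a small symmetric perturbation cannot destroy.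
\<close>

lemma posdef_open:
  fixes X :: "real^'n^'n"
  assumes "0 \<prec>\<^sub>L X"
  obtains d where "d > 0"
    "\<And>Y. transpose Y = Y \<Longrightarrow> norm (Y - X) < d \<Longrightarrow> 0 \<prec>\<^sub>L Y"
proof -
  have cont: "continuous_on (sphere 0 1) (\<lambda>v. v \<bullet> (X *v v))"
    by (intro continuous_intros)
  obtain u :: "real^'n" where u: "u \<in> sphere 0 1" "\<And>v. v \<in> sphere 0 1 \<Longrightarrow> u \<bullet> (X *v u) \<le> v \<bullet> (X *v v)"
    using continuous_attains_inf[OF compact_sphere _ cont] by auto
  define c where "c = u \<bullet> (X *v u)"
  have c: "c > 0"
  proof -
    have "u \<noteq> 0" using u(1) by auto
    then show ?thesis using assms by (simp add: c_def posdef_iff)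
  qed
  obtain K where K: "K > 0" "\<And>(Z::real^'n^'n) v. norm (Z *v v) \<le> norm Z * norm v * K"
    using bounded_bilinear.pos_bounded[OF bounded_bilinear_matrix_vector_mult] by blast
  show ?thesis
  proof
    show "c / K > 0" using c K(1) by simp
    fix Y :: "real^'n^'n"
    assume sym: "transpose Y = Y" and near: "norm (Y - X) < c / K"
    have "0 < v \<bullet> (Y *v v)" if "v \<noteq> 0" for v
    proof -
      define w where "w = v /\<^sub>R norm v"
      have w: "norm w = 1" "v = norm v *\<^sub>R w" using that by (auto simp: w_def)
      have "\<bar>w \<bullet> ((Y - X) *v w)\<bar> \<le> norm ((Y - X) *v w)"
        using Cauchy_Schwarz_ineq2[of w "(Y - X) *v w"] w(1) by simp
      also have "\<dots> \<le> norm (Y - X) * K" using K(2)[of "Y - X" w] w(1) by simp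
      also have "\<dots> < c" using near K(1) by (simp add: field_simps)
      also have "c \<le> w \<bullet> (X *v w)" using u(2)[of w] w(1) by (simp add: c_def)
      finally have "0 < w \<bullet> (Y *v w)" by (simp add: algebra_simps)
      moreover have "v \<bullet> (Y *v v) = (norm v)\<^sup>2 * (w \<bullet> (Y *v w))"
        by (subst (1 2) w(2)) (simp add: matrix_vector_mult_scaleR power2_eq_square del: w_def)
      ultimately show ?thesis using that by simp
    qed
    then show "0 \<prec>\<^sub>L Y" using sym by (simp add: posdef_iff)
  qed
qed

section \<open>The matrix exponential\<close>

text \<open>
  The exponential series is summed entry by entry, as a real power series in \<open>t\<close>, which makes
  termwise differentiation of real power series applicable.
\<close>

definition matrix_exp :: "real^'n^'n \<Rightarrow> real \<Rightarrow> real^'n^'n" where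
  "matrix_exp A t = (\<chi> i j. \<Sum>k. (mat_pow A k $ i $ j / fact k) * t ^ k)"

lemma mat_pow_Suc_right: "mat_pow A (Suc k) = mat_pow A k ** A"
  by (induction k) (simp_all, metis matrix_mul_assoc)

lemma mat_pow_entry_bound:
  fixes A :: "real^'n^'n"
  shows "\<bar>mat_pow A k $ i $ j\<bar> \<le> (\<Sum>i\<in>UNIV. \<Sum>j\<in>UNIV. \<bar>A $ i $ j\<bar>) ^ k"
proof (induction k arbitrary: i j)
  case 0
  show ?case by (simp add: mat_def)
next
  case (Suc k)
  let ?c = "\<Sum>i\<in>UNIV. \<Sum>j\<in>UNIV. \<bar>A $ i $ j\<bar>"
  have "\<bar>mat_pow A (Suc k) $ i $ j\<bar> \<le> (\<Sum>l\<in>UNIV. \<bar>A $ i $ l\<bar> * \<bar>mat_pow A k $ l $ j\<bar>)"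
    by (simp add: matrix_matrix_mult_def order_trans[OF sum_abs] abs_mult)
  also have "\<dots> \<le> (\<Sum>l\<in>UNIV. \<bar>A $ i $ l\<bar> * ?c ^ k)"
    by (intro sum_mono mult_left_mono Suc.IH) auto
  also have "\<dots> = (\<Sum>l\<in>UNIV. \<bar>A $ i $ l\<bar>) * ?c ^ k"
    by (simp add: sum_distrib_right)
  also have "\<dots> \<le> ?c * ?c ^ k"
    by (intro mult_right_mono member_le_sum[where f = "\<lambda>i. \<Sum>j\<in>UNIV. \<bar>A $ i $ j\<bar>"])
       (auto intro!: sum_nonneg zero_le_power)
  finally show ?case by simp
qed

lemma summable_matrix_exp_entry:
  fixes A :: "real^'n^'n"
  shows "summable (\<lambda>k. (mat_pow A k $ i $ j / fact k) * t ^ k)"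
proof (rule summable_comparison_test)
  let ?c = "\<Sum>i\<in>UNIV. \<Sum>j\<in>UNIV. \<bar>A $ i $ j\<bar>"
  have "norm ((mat_pow A k $ i $ j / fact k) * t ^ k) \<le> inverse (fact k) * (?c * \<bar>t\<bar>) ^ k" for k
    using mult_right_mono[OF mat_pow_entry_bound[of A k i j], of "\<bar>t\<bar> ^ k / fact k"]
    by (simp add: abs_mult power_abs power_mult_distrib field_simps)
  then show "\<exists>N. \<forall>k\<ge>N. norm ((mat_pow A k $ i $ j / fact k) * t ^ k)
      \<le> inverse (fact k) * (?c * \<bar>t\<bar>) ^ k"
    by blast
  show "summable (\<lambda>k. inverse (fact k) * (?c * \<bar>t\<bar>) ^ k)"
    by (rule summable_exp)
qed

lemma matrix_exp_0: "matrix_exp A 0 = mat 1"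
proof -
  have "(\<Sum>k. (mat_pow A k $ i $ j / fact k) * 0 ^ k) = mat 1 $ i $ j" for i j
    by (subst powser_zero) simp
  then show ?thesis unfolding matrix_exp_def by (simp only: vec_eq_iff vec_lambda_beta simp_thms)
qed

lemma has_vector_derivative_matrix_entries:
  fixes X :: "real \<Rightarrow> real^'n^'m"
  assumes "\<And>i j. ((\<lambda>t. X t $ i $ j) has_vector_derivative X' $ i $ j) (at t within S)"
  shows "(X has_vector_derivative X') (at t within S)"
  using assms unfolding has_vector_derivative_def
  by (subst has_derivative_componentwise_within) (auto simp: Basis_vec_def inner_axis)

lemma matrix_exp_entry_has_derivative:
  fixes A :: "real^'n^'n"
  shows "((\<lambda>t. matrix_exp A t $ i $ j) has_real_derivative
    (\<Sum>k. (mat_pow A (Suc k) $ i $ j / fact k) * t ^ k)) (at t)"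
proof -
  have "diffs (\<lambda>k. mat_pow A k $ i $ j / fact k) = (\<lambda>k. mat_pow A (Suc k) $ i $ j / fact k)"
    by (auto simp: diffs_def fun_eq_iff field_simps simp del: mat_pow.simps of_nat_Suc)
  then show ?thesis
    using termdiffs_strong_converges_everywhere[OF summable_matrix_exp_entry[of A i j], of t]
    by (simp add: matrix_exp_def)
qed

text \<open>
  Both forms are needed: together they let the derivative of \<open>e\<^sup>-\<^sup>t\<^sup>A e\<^sup>t\<^sup>A\<close> cancel.
\<close>

lemma matrix_exp_has_derivative:
  fixes A :: "real^'n^'n"
  shows "(matrix_exp A has_vector_derivative A ** matrix_exp A t) (at t)"
    and "(matrix_exp A has_vector_derivative matrix_exp A t ** A) (at t)"
proof -
  have *: "(\<Sum>k. (\<Sum>l\<in>UNIV. a l * ((mat_pow A k $ p l $ q l / fact k) * t ^ k)))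
    = (\<Sum>l\<in>UNIV. a l * (\<Sum>k. (mat_pow A k $ p l $ q l / fact k) * t ^ k))" 
    for a :: "'n \<Rightarrow> real" and p q
    by (simp only: suminf_sum[OF summable_mult[OF summable_matrix_exp_entry]]
        suminf_mult[OF summable_matrix_exp_entry])
  have 1: "(\<Sum>k. (mat_pow A (Suc k) $ i $ j / fact k) * t ^ k) = (A ** matrix_exp A t) $ i $ j" for i j
    using *[of "\<lambda>l. A $ i $ l" "\<lambda>l. l" "\<lambda>l. j"]
    by (simp add: matrix_matrix_mult_def matrix_exp_def sum_distrib_left sum_divide_distrib mult_ac)
  have 2: "(\<Sum>k. (mat_pow A (Suc k) $ i $ j / fact k) * t ^ k) = (matrix_exp A t ** A) $ i $ j" for i j
    using *[of "\<lambda>l. A $ l $ j" "\<lambda>l. i" "\<lambda>l. l"]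
    by (simp add: mat_pow_Suc_right matrix_matrix_mult_def matrix_exp_def sum_distrib_left
        sum_divide_distrib mult_ac del: mat_pow.simps)
  show "(matrix_exp A has_vector_derivative A ** matrix_exp A t) (at t)"
    using matrix_exp_entry_has_derivative[of A _ _ t, unfolded 1]
    unfolding has_real_derivative_iff_has_vector_derivative
    by (rule has_vector_derivative_matrix_entries)
  show "(matrix_exp A has_vector_derivative matrix_exp A t ** A) (at t)"
    using matrix_exp_entry_has_derivative[of A _ _ t, unfolded 2]
    unfolding has_real_derivative_iff_has_vector_derivative
    by (rule has_vector_derivative_matrix_entries)
qed

lemma matrix_exp_minus_has_derivative:
  fixes A :: "real^'n^'n"
  shows "((\<lambda>t. matrix_exp A (- t)) has_vector_derivative - (matrix_exp A (- t) ** A)) (at t)"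
proof -
  have "((\<lambda>t. - t) has_vector_derivative (- 1)) (at t)"
    by (auto intro!: derivative_eq_intros)
  from vector_diff_chain_at[OF this, of "matrix_exp A" "matrix_exp A (- t) ** A"]
    matrix_exp_has_derivative(2)[of A "- t"]
  show ?thesis by (simp add: o_def)
qed

lemma matrix_exp_minus_mult: "matrix_exp A (- t) ** matrix_exp A t = mat 1"
proof -
  have "((\<lambda>t. matrix_exp A (- t) ** matrix_exp A t) has_vector_derivative 0) (at t within UNIV)" for t
    by (rule has_vector_derivative_eq_rhs[OF has_vector_derivative_matrix_mult[OF
            matrix_exp_minus_has_derivative matrix_exp_has_derivative(1)]])
       (simp add: matrix_mult_linear_simps matrix_mul_assoc)
  then obtain c where "\<And>t. matrix_exp A (- t) ** matrix_exp A t = c"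
    using has_vector_derivative_zero_constant[of UNIV] by auto
  from this[of t] this[of 0] show ?thesis by (simp add: matrix_exp_0)
qed

section \<open>Controllability\<close>

text \<open>
  Kalman's rank condition says that the columns of all \<open>A\<^sup>k B\<close> span the space, and \<open>\<zeta>\<close> is orthogonal to
  them, hence to itself.
\<close>

lemma controllable_left_kernel:
  fixes A :: "real^'n^'n" and B :: "real^'p^'n"
  assumes "controllable A B" and "\<And>k. \<zeta> v* (mat_pow A k ** B) = 0"
  shows "\<zeta> = 0"
proof -
  have "surj ((*v) (controllability_matrix A B))"
    using assms(1) by (simp add: controllable_def full_rank_surjective)
  then obtain x where x: "\<zeta> = controllability_matrix A B *v x" by (metis surjD)
  have "\<zeta> v* controllability_matrix A B = 0"
  proof -
    have "(\<Sum>i\<in>UNIV. \<zeta> $ i * (mat_pow A k ** B) $ i $ j) = 0" for k j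
      using assms(2)[of k] by (simp add: vec_eq_iff vector_matrix_mult_def mult_ac)
    then show ?thesis
      by (simp add: vec_eq_iff vector_matrix_mult_def controllability_matrix_def mult_ac)
  qed
  then have "\<zeta> \<bullet> \<zeta> = 0"
    by (subst (2) x) (simp flip: dot_lmul_matrix)
  then show ?thesis by simp
qed

text \<open>
  Differentiating \<open>\<eta>\<^sup>T e\<^sup>-\<^sup>t\<^sup>A B = 0\<close> repeatedly gives \<open>\<eta>\<^sup>T e\<^sup>-\<^sup>t\<^sup>A A\<^sup>k B = 0\<close> for every \<open>k\<close>, so
  \<open>\<eta>\<^sup>T e\<^sup>-\<^sup>t\<^sup>A\<close> lies in the left kernel of the controllability matrix.
\<close>

lemma controllable_excitation:
  fixes A :: "real^'n^'n" and B :: "real^'p^'n"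
  assumes contr: "controllable A B" and "a < b"
    and zero: "\<And>t. t \<in> {a<..<b} \<Longrightarrow> \<eta> v* (matrix_exp A (- t) ** B) = 0"
  shows "\<eta> = 0"
proof -
  have deriv: "\<eta> v* (matrix_exp A (- t) ** mat_pow A k ** B) = 0" if "t \<in> {a<..<b}" for k t
    using that
  proof (induction k arbitrary: t)
    case 0
    then show ?case using zero by simp
  next
    case (Suc k)
    have lin: "bounded_linear (\<lambda>X. \<eta> v* (X ** mat_pow A k ** B))"
      by (auto simp: linear_conv_bounded_linear[symmetric] linear_iff matrix_mult_linear_simps
          vector_matrix_mult_add_rdistrib vector_scaleR_matrix_ac scaleR_vector_matrix_assoc)
    have "((\<lambda>t. \<eta> v* (matrix_exp A (- t) ** mat_pow A k ** B)) has_vector_derivative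
        \<eta> v* (- (matrix_exp A (- t) ** A) ** mat_pow A k ** B)) (at t)"
      by (rule bounded_linear.has_vector_derivative[OF lin matrix_exp_minus_has_derivative])
    moreover have "((\<lambda>t. \<eta> v* (matrix_exp A (- t) ** mat_pow A k ** B)) has_vector_derivative 0) (at t)"
      by (rule has_vector_derivative_transform_within_open[where f = "\<lambda>_. 0" and S = "{a<..<b}"])
         (use Suc in auto)
    ultimately have "\<eta> v* (- (matrix_exp A (- t) ** A) ** mat_pow A k ** B) = 0"
      using vector_derivative_unique_at by blast
    moreover have "\<eta> v* (- (matrix_exp A (- t) ** A) ** mat_pow A k ** B)
        = - (\<eta> v* (matrix_exp A (- t) ** mat_pow A (Suc k) ** B))"
      using linear_neg[OF bounded_linear.linear[OF lin], of "matrix_exp A (- t) ** A"]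
      by (simp add: matrix_mul_assoc)
    ultimately show ?case by simp
  qed
  define t where "t = (a + b) / 2"
  have t: "t \<in> {a<..<b}" using \<open>a < b\<close> by (auto simp: t_def)
  have "\<eta> v* matrix_exp A (- t) = 0"
    by (rule controllable_left_kernel[OF contr])
       (use deriv[OF t] in \<open>simp add: vector_matrix_mul_assoc matrix_mul_assoc\<close>)
  then have "\<eta> v* (matrix_exp A (- t) ** matrix_exp A t) = 0"
    by (simp flip: vector_matrix_mul_assoc)
  then show ?thesis by (simp add: matrix_exp_minus_mult)
qed

section \<open>Steering without drift\<close>

text \<open>
  If \<open>\<eta>\<close> is in the kernel, then \<open>0 = \<integral> w \<bar>B\<^sup>T \<eta>\<bar>\<^sup>2\<close>, so \<open>B\<^sup>T \<eta>\<close> vanishes wherever the weight is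
  positive. The weight makes it possible to use the control on part of the interval only and
  still keep it continuous.
\<close>

lemma gramian_invertible:
  fixes B :: "real \<Rightarrow> real^'p^'n" and w :: "real \<Rightarrow> real"
  assumes contB: "continuous_on {0..1} B" and contw: "continuous_on {0..1} w"
    and w: "\<And>t. t \<in> {0..1} \<Longrightarrow> 0 \<le> w t"
    and excite: "\<And>\<eta>. (\<And>t. t \<in> {0..1} \<Longrightarrow> w t > 0 \<Longrightarrow> \<eta> v* B t = 0) \<Longrightarrow> \<eta> = 0"
  shows "invertible (integral {0..1} (\<lambda>t. w t *\<^sub>R (B t ** transpose (B t))))"
proof -
  let ?g = "\<lambda>t. w t *\<^sub>R (B t ** transpose (B t))"
  have contg: "continuous_on {0..1} ?g"
    by (intro continuous_intros continuous_on_matrix_mult continuous_on_transpose contB contw)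
  have "\<eta> = 0" if ker: "integral {0..1} ?g *v \<eta> = 0" for \<eta>
  proof -
    have form: "\<eta> \<bullet> (?g t *v \<eta>) = w t * ((\<eta> v* B t) \<bullet> (\<eta> v* B t))" for t
      using dot_lmul_matrix[of \<eta> "B t" "\<eta> v* B t"]
      by (simp add: scaleR_matrix_vector_assoc[symmetric] flip: matrix_vector_mul_assoc)
    have lin: "bounded_linear (\<lambda>X :: real^'n^'n. \<eta> \<bullet> (X *v \<eta>))"
      using bounded_linear_compose[OF bounded_linear_inner_right
          bounded_bilinear.bounded_linear_left[OF bounded_bilinear_matrix_vector_mult]] .
    have "integral {0..1} (\<lambda>t. \<eta> \<bullet> (?g t *v \<eta>)) = \<eta> \<bullet> (integral {0..1} ?g *v \<eta>)"
      using integral_linear[OF integrable_continuous_real[OF contg] lin] by (simp add: o_def)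
    then have "integral {0..1} (\<lambda>t. \<eta> \<bullet> (?g t *v \<eta>)) = 0"
      by (simp add: ker)
    moreover have "continuous_on {0..1} (\<lambda>t. \<eta> \<bullet> (?g t *v \<eta>))"
      by (rule bounded_linear.continuous_on[OF lin contg])
    moreover have "0 \<le> \<eta> \<bullet> (?g t *v \<eta>)" if "t \<in> {0..1}" for t
      unfolding form using w[OF that] by simp
    ultimately have "\<forall>t\<in>{0..1}. \<eta> \<bullet> (?g t *v \<eta>) = 0"
      using integral_eq_0_iff[of 0 1 "\<lambda>t. \<eta> \<bullet> (?g t *v \<eta>)"] by simp
    then have "\<forall>t\<in>{0..1}. w t = 0 \<or> \<eta> v* B t = 0"
      unfolding form by simp
    then show ?thesis by (intro excite) force
  qed
  then show ?thesis
    using matrix_left_invertible_ker invertible_left_inverse by blast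
qed

text \<open>
  The control idles until a late time \<open>s\<close> and then exchanges the covariance \<open>P s\<close> for a matrix \<open>T\<close>
  that together with the remaining noise amounts to \<open>S\<^sub>1\<close>. The excitation hypothesis is
  required on every final interval, since \<open>s\<close> must be chosen close to \<open>1\<close>, depending on \<open>M\<close> and \<open>S\<^sub>1\<close>.
\<close>

lemma driftless_steering:
  fixes B :: "real \<Rightarrow> real^'p^'n" and M :: "real \<Rightarrow> real^'n^'n"
  assumes contB: "continuous_on {0..1} B" and contM: "continuous_on {0..1} M"
    and psd: "\<And>t. t \<in> {0..1} \<Longrightarrow> 0 \<preceq>\<^sub>L M t"
    and S\<^sub>0: "0 \<prec>\<^sub>L S\<^sub>0" and S\<^sub>1: "0 \<prec>\<^sub>L S\<^sub>1"
    and excite: "\<And>s \<eta>. 0 \<le> s \<Longrightarrow> s < 1 \<Longrightarrow> (\<And>t. t \<in> {s<..<1} \<Longrightarrow> \<eta> v* B t = 0) \<Longrightarrow> \<eta> = 0"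
  obtains S V where "continuous_on {0..1} V" "S 0 = S\<^sub>0" "S 1 = S\<^sub>1"
    "\<And>t. t \<in> {0..1} \<Longrightarrow> 0 \<prec>\<^sub>L S t"
    "\<And>t. t \<in> {0..1} \<Longrightarrow> (S has_vector_derivative
        M t + B t ** V t + transpose (B t ** V t)) (at t within {0..1})"
proof -
  define P where "P t = S\<^sub>0 + integral {0..t} M" for t
  have P_der: "(P has_vector_derivative M t) (at t within {0..1})" if "t \<in> {0..1}" for t
    unfolding P_def
    using has_vector_derivative_add[OF has_vector_derivative_const
        integral_has_vector_derivative[OF contM that]] by simp
  have P_0: "P 0 = S\<^sub>0" by (simp add: P_def)
  have P_sym: "transpose (P t) = P t" if "t \<in> {0..1}" for t
  proof -
    have "transpose (P t) - P t = 0"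
    proof (rule zero_if_derivative_norm_le[where C = 0 and f' = "\<lambda>_. 0" and b = 1])
      fix r :: real assume r: "r \<in> {0..1}"
      show "((\<lambda>t. transpose (P t) - P t) has_vector_derivative 0) (at r within {0..1})"
        by (rule has_vector_derivative_eq_rhs[OF has_vector_derivative_diff[OF
                has_vector_derivative_transpose[OF P_der[OF r]] P_der[OF r]]])
           (use psd[OF r] in \<open>simp add: psd_iff\<close>)
    qed (use that S\<^sub>0 in \<open>auto simp: P_0 posdef_iff\<close>)
    then show ?thesis by simp
  qed
  have P_mono: "v \<bullet> (P a *v v) \<le> v \<bullet> (P b *v v)" if "0 \<le> a" "a \<le> b" "b \<le> 1" for a b v
  proof -
    have "((\<lambda>t. v \<bullet> (M t *v v)) has_integral (v \<bullet> (P b *v v) - v \<bullet> (P a *v v))) {a..b}"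
      using that by (intro fundamental_theorem_of_calculus
          has_vector_derivative_within_subset[OF has_vector_derivative_quadratic_form[OF P_der]]) auto
    then have "0 \<le> v \<bullet> (P b *v v) - v \<bullet> (P a *v v)"
      by (rule has_integral_nonneg) (use psd that in \<open>auto simp: psd_iff\<close>)
    then show ?thesis by simp
  qed
  have P_pos: "0 \<prec>\<^sub>L P t" if "t \<in> {0..1}" for t
    unfolding posdef_iff
  proof (intro conjI allI impI)
    fix v :: "real^'n" assume "v \<noteq> 0"
    then have "0 < v \<bullet> (P 0 *v v)" using S\<^sub>0 by (simp add: P_0 posdef_iff)
    also have "\<dots> \<le> v \<bullet> (P t *v v)" by (rule P_mono) (use that in auto)
    finally show "0 < v \<bullet> (P t *v v)" .
  qed (rule P_sym[OF that])

  obtain d where d: "d > 0"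
    "\<And>Y. transpose Y = Y \<Longrightarrow> norm (Y - S\<^sub>1) < d \<Longrightarrow> 0 \<prec>\<^sub>L Y"
    using posdef_open[OF S\<^sub>1] by blast
  obtain s where s: "0 \<le> s" "s < 1" and s_near: "norm (P s - P 1) < d"
  proof -
    have "continuous_on {0..1} P"
      using P_der has_vector_derivative_continuous continuous_on_eq_continuous_within by blast
    then obtain e where e: "e > 0" "\<And>r. r \<in> {0..1} \<Longrightarrow> dist r 1 < e \<Longrightarrow> dist (P r) (P 1) < d"
      using d(1) unfolding continuous_on_iff by (metis atLeastAtMost_iff order_refl zero_le_one)
    show ?thesis
      by (rule that[of "max 0 (1 - e / 2)"])
         (use e in \<open>auto simp: dist_norm max_def intro!: e(2)[unfolded dist_norm]\<close>)
  qed
  define T where "T = S\<^sub>1 - (P 1 - P s)"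
  have T_pos: "0 \<prec>\<^sub>L T"
    using s s_near S\<^sub>1 P_sym[of s] P_sym[of 1] by (intro d(2)) (auto simp: T_def posdef_iff transpose_linear_simps)

  \<comment> \<open>The weight vanishes up to time s and is continuous there, so that the control switches on
    without a jump.\<close>
  define w where "w t = max 0 (t - s)" for t
  define \<Gamma> where "\<Gamma> t = integral {0..t} (\<lambda>r. w r *\<^sub>R (B r ** transpose (B r)))" for t
  have contw: "continuous_on {0..1} w" unfolding w_def by (intro continuous_intros)
  have \<Gamma>_der: "(\<Gamma> has_vector_derivative w t *\<^sub>R (B t ** transpose (B t))) (at t within {0..1})"
    if "t \<in> {0..1}" for t
    unfolding \<Gamma>_def
    by (intro integral_has_vector_derivative[OF _ that] continuous_intros continuous_on_matrix_mult
        continuous_on_transpose contB contw)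
  have \<Gamma>_inv: "invertible (\<Gamma> 1)"
    unfolding \<Gamma>_def
    by (rule gramian_invertible[OF contB contw])
       (use s in \<open>auto simp: w_def intro!: excite[of s]\<close>)
  have \<Gamma>_0: "\<Gamma> t = 0" if "t \<le> s" for t
    unfolding \<Gamma>_def by (rule integral_unique, rule has_integral_is_0) (use that in \<open>auto simp: w_def\<close>)

  define G where "G t = \<Gamma> t ** matrix_inv (\<Gamma> 1)" for t
  define W where "W t = w t *\<^sub>R (transpose (B t) ** matrix_inv (\<Gamma> 1))" for t
  have G_0: "G t = 0" if "t \<le> s" for t
    by (simp add: G_def \<Gamma>_0[OF that] matrix_mult_zero_simps)
  have G_1: "G 1 = mat 1"
    by (simp add: G_def matrix_inv_mult[OF \<Gamma>_inv])
  have G_der: "(G has_vector_derivative B t ** W t) (at t within {0..1})" if "t \<in> {0..1}" for t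
    unfolding G_def
    by (rule has_vector_derivative_eq_rhs[OF has_vector_derivative_matrix_mult[OF
            \<Gamma>_der[OF that] has_vector_derivative_const]])
       (simp add: W_def matrix_mult_linear_simps matrix_mult_zero_simps matrix_mul_assoc)
  have contG: "continuous_on {0..1} G"
    using G_der has_vector_derivative_continuous continuous_on_eq_continuous_within by blast
  have contW: "continuous_on {0..1} W"
    unfolding W_def
    by (intro continuous_intros continuous_on_matrix_mult continuous_on_transpose contB contw)

  \<comment> \<open>This form of S makes its derivative, and hence V, visible, and it is valid before s as well,
    where G is 0 and S agrees with P; the split form below shows positivity after s.\<close>
  define S where "S t = P t - G t ** P s - P s ** transpose (G t) + G t ** (P s + T) ** transpose (G t)" for t
  define V where "V t = W t ** ((P s + T) ** transpose (G t) - P s)" for t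
  have symPs: "transpose (P s) = P s" and symT: "transpose T = T"
    using P_sym[of s] s T_pos by (auto simp: posdef_iff)
  have S_split: "S t = (mat 1 - G t) ** P s ** transpose (mat 1 - G t)
      + G t ** T ** transpose (G t) + (P t - P s)" for t
    by (simp add: S_def transpose_linear_simps matrix_mult_linear_simps)
  show ?thesis
  proof
    show "continuous_on {0..1} V"
      unfolding V_def
      by (intro continuous_intros continuous_on_matrix_mult continuous_on_transpose contG contW)
    show "S 0 = S\<^sub>0"
      using s by (simp add: S_def G_0 P_0 matrix_mult_zero_simps transpose_linear_simps)
    show "S 1 = S\<^sub>1"
      by (simp add: S_split G_1 T_def matrix_mult_zero_simps transpose_linear_simps)
  next
    fix t :: real assume t: "t \<in> {0..1}"
    show "(S has_vector_derivative M t + B t ** V t + transpose (B t ** V t)) (at t within {0..1})"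
      unfolding S_def
      by (rule has_vector_derivative_eq_rhs)
         (rule has_vector_derivative_add has_vector_derivative_diff has_vector_derivative_matrix_mult
            has_vector_derivative_transpose has_vector_derivative_const P_der G_der t refl
          | simp add: V_def matrix_mult_linear_simps matrix_mult_zero_simps transpose_linear_simps
            matrix_transpose_mul matrix_mul_assoc symPs symT)+
    show "0 \<prec>\<^sub>L S t"
    proof (cases "t \<le> s")
      case True
      then show ?thesis
        using P_pos[OF t] by (simp add: S_def G_0 matrix_mult_zero_simps transpose_linear_simps)
    next
      case False
      have sym: "transpose (S t) = S t"
        using P_sym[OF t] symPs symT
        unfolding S_split transpose_linear_simps(1)[of "_ + _"] transpose_linear_simps(1)[of "_ ** _"]
          transpose_linear_simps(2)[of "P t" "P s"]
        by (simp only: transpose_congruence)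
      have "0 < v \<bullet> (S t *v v)" if "v \<noteq> 0" for v
      proof -
        let ?a = "v v* (mat 1 - G t)" and ?b = "v v* G t"
        have form: "v \<bullet> (S t *v v) = ?a \<bullet> (P s *v ?a) + ?b \<bullet> (T *v ?b)
            + (v \<bullet> (P t *v v) - v \<bullet> (P s *v v))"
          unfolding S_split
          by (simp only: matrix_vector_mult_add_rdistrib inner_add_right quadratic_form_congruence
              matrix_vector_mult_diff_rdistrib inner_diff_right)
        have "?a + ?b = v"
          by (simp add: vector_matrix_mult_diff_rdistrib)
        then have "?a \<noteq> 0 \<or> ?b \<noteq> 0" using that by auto
        moreover have "0 \<le> x \<bullet> (P s *v x)" "x \<noteq> 0 \<Longrightarrow> 0 < x \<bullet> (P s *v x)"
          "0 \<le> x \<bullet> (T *v x)" "x \<noteq> 0 \<Longrightarrow> 0 < x \<bullet> (T *v x)" for x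
          using P_pos[of s] T_pos s by (auto simp: posdef_iff less_imp_le intro: order.strict_implies_order) (metis inner_zero_left less_imp_le order_refl)+
        ultimately have "0 < ?a \<bullet> (P s *v ?a) + ?b \<bullet> (T *v ?b)"
          by (metis add_nonneg_pos add_pos_nonneg)
        moreover have "v \<bullet> (P s *v v) \<le> v \<bullet> (P t *v v)"
          by (rule P_mono) (use False s t in auto)
        ultimately show ?thesis unfolding form by linarith
      qed
      then show ?thesis using sym by (simp add: posdef_iff)
    qed
  qed
qed

section \<open>The covariance equation\<close>

lemma Ck_on_imp_continuous_on: "Ck_on k S f \<Longrightarrow> continuous_on S f"
proof (cases k)
  case (Suc m)
  assume "Ck_on k S f"
  with Suc obtain f' where "\<forall>t\<in>S. (f has_vector_derivative f' t) (at t within S)" by auto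
  then show ?thesis
    unfolding continuous_on_eq_continuous_within by (blast intro: has_vector_derivative_continuous)
qed simp

text \<open>
  The difference of two solutions solves the homogeneous linear equation, whose coefficients are
  bounded on the compact interval, and Gronwall applies.
\<close>

lemma covariance_ode_unique:
  fixes A :: "real^'n^'n" and B :: "real^'p^'n"
  assumes contK: "continuous_on {0..1} K" and cont\<nu>: "continuous_on {0..1} \<nu>"
    and X: "solves_covariance_ode A B K M \<nu> X" and Y: "solves_covariance_ode A B K M \<nu> Y"
    and init: "X 0 = Y 0" and t: "t \<in> {0..1}"
  shows "X t = Y t"
proof -
  define F where "F t = A + B ** K t" for t
  define D where "D t = X t - Y t" for t
  define D' where "D' t = F t ** D t + D t ** transpose (F t) + (2 * \<nu> t) *\<^sub>R D t" for t
  obtain \<kappa> where \<kappa>: "\<kappa> > 0"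
    "\<And>U V. norm ((U :: real^'n^'n) ** (V :: real^'n^'n)) \<le> norm U * norm V * \<kappa>"
    using bounded_bilinear.pos_bounded[OF bounded_bilinear_matrix_mult] by blast
  define c where "c t = norm (F t) * \<kappa> + norm (transpose (F t)) * \<kappa> + 2 * \<bar>\<nu> t\<bar>" for t
  have "continuous_on {0..1} c"
    unfolding c_def F_def
    by (intro continuous_intros continuous_on_matrix_mult continuous_on_transpose contK cont\<nu>)
  then have "\<exists>r\<in>{0..1}. \<forall>t\<in>{0..1}. c t \<le> c r"
    by (intro continuous_attains_sup) auto
  then obtain r where r: "\<And>t. t \<in> {0..1} \<Longrightarrow> c t \<le> c r"
    by blast
  have "D t = 0"
  proof (rule zero_if_derivative_norm_le[OF _ _ _ t])
    fix t :: real assume t: "t \<in> {0..1}"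
    show "(D has_vector_derivative D' t) (at t within {0..1})"
      unfolding D_def
      by (rule has_vector_derivative_eq_rhs[OF has_vector_derivative_diff])
         (use X Y t in \<open>auto simp: solves_covariance_ode_def D'_def D_def F_def
            matrix_mult_linear_simps algebra_simps\<close>)
    have "norm (D' t) \<le> norm (F t ** D t) + norm (D t ** transpose (F t)) + norm ((2 * \<nu> t) *\<^sub>R D t)"
      unfolding D'_def by (intro norm_triangle_le add_mono order_refl)
    also have "\<dots> \<le> norm (F t) * norm (D t) * \<kappa> + norm (D t) * norm (transpose (F t)) * \<kappa>
        + 2 * \<bar>\<nu> t\<bar> * norm (D t)"
      by (intro add_mono \<kappa>(2)) (simp add: abs_mult)
    also have "\<dots> = c t * norm (D t)" by (simp add: c_def algebra_simps)
    also have "\<dots> \<le> c r * norm (D t)" by (intro mult_right_mono r t) auto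
    finally show "norm (D' t) \<le> c r * norm (D t)" .
  qed (simp add: D_def init)
  then show ?thesis by (simp add: D_def)
qed

theorem theorem2:
  fixes A :: "real^'n^'n" and B :: "real^'p^'n"
    and \<Sigma>\<^sub>0 \<Sigma>\<^sub>1 :: "real^'n^'n"
    and M :: "real \<Rightarrow> real^'n^'n" and \<nu> :: "real \<Rightarrow> real"
  assumes "controllable A B"
    and "0 \<prec>\<^sub>L \<Sigma>\<^sub>0" and "0 \<prec>\<^sub>L \<Sigma>\<^sub>1"
    and "Ck_on (CARD('n) - 2) {0..1} M" and "Ck_on (CARD('n) - 2) {0..1} \<nu>"
    and "\<And>t. t \<in> {0..1} \<Longrightarrow> 0 \<preceq>\<^sub>L M t"
    and "\<And>t. t \<in> {0..1} \<Longrightarrow> 0 \<le> \<nu> t"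
  shows "\<exists>K :: real \<Rightarrow> real^'n^'p. continuous_on {0..1} K \<and>
    (\<exists>\<Sigma>. solves_covariance_ode A B K M \<nu> \<Sigma> \<and> \<Sigma> 0 = \<Sigma>\<^sub>0) \<and>
    (\<forall>\<Sigma>. solves_covariance_ode A B K M \<nu> \<Sigma> \<and> \<Sigma> 0 = \<Sigma>\<^sub>0 \<longrightarrow>
      (\<forall>t\<in>{0..1}. 0 \<prec>\<^sub>L \<Sigma> t) \<and> \<Sigma> 1 = \<Sigma>\<^sub>1)"
proof -
  have contM: "continuous_on {0..1} M" and cont\<nu>: "continuous_on {0..1} \<nu>"
    using assms(4,5) by (auto dest: Ck_on_imp_continuous_on)
  define J where "J t = integral {0..t} \<nu>" for t
  define \<Phi> where "\<Phi> t = exp (J t) *\<^sub>R matrix_exp A t" for t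
  define \<Psi> where "\<Psi> t = exp (- J t) *\<^sub>R matrix_exp A (- t)" for t
  have J_der: "(J has_real_derivative \<nu> t) (at t within {0..1})" if "t \<in> {0..1}" for t
    unfolding J_def has_real_derivative_iff_has_vector_derivative
    by (rule integral_has_vector_derivative[OF cont\<nu> that])
  have contJ: "continuous_on {0..1} J"
    using J_der DERIV_continuous_on by blast
  have inv1: "\<Psi> t ** \<Phi> t = mat 1" for t
    by (simp add: \<Phi>_def \<Psi>_def matrix_mult_linear_simps matrix_exp_minus_mult flip: exp_add)
  have inv2: "\<Phi> t ** \<Psi> t = mat 1" for t
    using inv1 matrix_left_right_inverse by blast
  have \<Phi>_der: "(\<Phi> has_vector_derivative A ** \<Phi> t + \<nu> t *\<^sub>R \<Phi> t) (at t within {0..1})"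
    if "t \<in> {0..1}" for t
  proof -
    have "((\<lambda>t. exp (J t)) has_real_derivative exp (J t) * \<nu> t) (at t within {0..1})"
      by (auto intro!: derivative_eq_intros J_der[OF that])
    from has_vector_derivative_scaleR[OF this
        has_vector_derivative_at_within[OF matrix_exp_has_derivative(1)]]
    show ?thesis
      unfolding \<Phi>_def
      by (rule has_vector_derivative_eq_rhs) (simp add: matrix_mult_linear_simps mult.commute)
  qed
  have cont\<Phi>: "continuous_on {0..1} \<Phi>"
    using \<Phi>_der has_vector_derivative_continuous continuous_on_eq_continuous_within by blast
  have cont\<Psi>: "continuous_on {0..1} \<Psi>"
    unfolding \<Psi>_def
    by (intro continuous_intros contJ continuous_at_imp_continuous_on ballI
        has_vector_derivative_continuous[OF matrix_exp_minus_has_derivative])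

  obtain S V where contV: "continuous_on {0..1} V"
    and S_0: "S 0 = \<Sigma>\<^sub>0" and S_1: "S 1 = \<Psi> 1 ** \<Sigma>\<^sub>1 ** transpose (\<Psi> 1)"
    and S_pos: "\<And>t. t \<in> {0..1} \<Longrightarrow> 0 \<prec>\<^sub>L S t"
    and S_der: "\<And>t. t \<in> {0..1} \<Longrightarrow> (S has_vector_derivative
        \<Psi> t ** M t ** transpose (\<Psi> t) + (\<Psi> t ** B) ** V t + transpose ((\<Psi> t ** B) ** V t))
        (at t within {0..1})"
  proof (rule driftless_steering)
    show "continuous_on {0..1} (\<lambda>t. \<Psi> t ** B)"
      "continuous_on {0..1} (\<lambda>t. \<Psi> t ** M t ** transpose (\<Psi> t))"
      by (intro continuous_intros continuous_on_matrix_mult continuous_on_transpose cont\<Psi> contM)+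
    show "0 \<preceq>\<^sub>L \<Psi> t ** M t ** transpose (\<Psi> t)" if "t \<in> {0..1}" for t
      by (intro psd_congruence assms(6) that)
    show "0 \<prec>\<^sub>L \<Sigma>\<^sub>0" by (rule assms(2))
    show "0 \<prec>\<^sub>L \<Psi> 1 ** \<Sigma>\<^sub>1 ** transpose (\<Psi> 1)"
      by (rule posdef_congruence[OF assms(3) inv1])
    fix s :: real and \<eta> :: "real^'n"
    assume "s < 1" and zero: "\<And>t. t \<in> {s<..<1} \<Longrightarrow> \<eta> v* (\<Psi> t ** B) = 0"
    show "\<eta> = 0"
    proof (rule controllable_excitation[OF assms(1) \<open>s < 1\<close>])
      fix t assume "t \<in> {s<..<1}"
      from zero[OF this] show "\<eta> v* (matrix_exp A (- t) ** B) = 0"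
        by (simp add: \<Psi>_def matrix_mult_linear_simps vector_scaleR_matrix_ac
            scaleR_vector_matrix_assoc)
    qed
  qed (use that in blast)

  define \<Sigma> where "\<Sigma> t = \<Phi> t ** S t ** transpose (\<Phi> t)" for t
  define K where "K t = V t ** transpose (\<Phi> t) ** matrix_inv (\<Sigma> t)" for t
  have \<Sigma>_pos: "0 \<prec>\<^sub>L \<Sigma> t" if "t \<in> {0..1}" for t
    unfolding \<Sigma>_def by (rule posdef_congruence[OF S_pos[OF that] inv2])
  have inv3: "transpose (\<Psi> t) ** transpose (\<Phi> t) = mat 1" for t
    using inv2[of t] by (simp flip: matrix_transpose_mul)
  have conj_inverse: "\<Phi> t ** (\<Psi> t ** X ** transpose (\<Psi> t)) ** transpose (\<Phi> t) = X"
    for t and X :: "real^'n^'n"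
  proof -
    have "\<Phi> t ** (\<Psi> t ** X ** transpose (\<Psi> t)) ** transpose (\<Phi> t)
        = (\<Phi> t ** \<Psi> t) ** X ** (transpose (\<Psi> t) ** transpose (\<Phi> t))"
      by (simp only: matrix_mul_assoc)
    then show ?thesis by (simp add: inv2 inv3)
  qed
  have \<Sigma>_0: "\<Sigma> 0 = \<Sigma>\<^sub>0"
    by (simp add: \<Sigma>_def \<Phi>_def J_def matrix_exp_0 S_0)
  have \<Sigma>_1: "\<Sigma> 1 = \<Sigma>\<^sub>1"
    unfolding \<Sigma>_def S_1 by (rule conj_inverse)
  have contK: "continuous_on {0..1} K"
  proof -
    have "continuous_on {0..1} S"
      using S_der has_vector_derivative_continuous continuous_on_eq_continuous_within by blast
    then have "continuous_on {0..1} \<Sigma>"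
      unfolding \<Sigma>_def by (intro continuous_on_matrix_mult continuous_on_transpose cont\<Phi>)
    then show ?thesis
      unfolding K_def
      by (intro continuous_on_matrix_mult continuous_on_transpose cont\<Phi> contV continuous_on_matrix_inv
          invertible_posdef \<Sigma>_pos)
  qed
  have solves: "solves_covariance_ode A B K M \<nu> \<Sigma>"
    unfolding solves_covariance_ode_def
  proof
    fix t :: real assume t: "t \<in> {0..1}"
    have K\<Sigma>: "K t ** \<Sigma> t = V t ** transpose (\<Phi> t)"
      using matrix_inv_mult(2)[OF invertible_posdef[OF \<Sigma>_pos[OF t]]]
      by (simp add: K_def flip: matrix_mul_assoc)
    have \<Sigma>_sym: "transpose (\<Sigma> t) = \<Sigma> t"
      using \<Sigma>_pos[OF t] by (simp add: posdef_iff)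
    have B_left: "\<Phi> t ** ((\<Psi> t ** B) ** V t) ** transpose (\<Phi> t) = B ** K t ** \<Sigma> t"
      by (simp add: matrix_mul_assoc inv2) (simp add: K\<Sigma> flip: matrix_mul_assoc)
    have B_right: "\<Phi> t ** transpose ((\<Psi> t ** B) ** V t) ** transpose (\<Phi> t) = \<Sigma> t ** transpose (B ** K t)"
      using arg_cong[OF B_left, of transpose] by (simp add: matrix_transpose_mul matrix_mul_assoc \<Sigma>_sym)
    have "(\<Sigma> has_vector_derivative
        (\<Phi> t ** S t) ** transpose (A ** \<Phi> t + \<nu> t *\<^sub>R \<Phi> t)
        + (\<Phi> t ** (\<Psi> t ** M t ** transpose (\<Psi> t) + (\<Psi> t ** B) ** V t + transpose ((\<Psi> t ** B) ** V t))
          + (A ** \<Phi> t + \<nu> t *\<^sub>R \<Phi> t) ** S t) ** transpose (\<Phi> t)) (at t within {0..1})"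
      unfolding \<Sigma>_def
      by (intro has_vector_derivative_matrix_mult has_vector_derivative_transpose \<Phi>_der S_der t)
    then show "(\<Sigma> has_vector_derivative
        (A + B ** K t) ** \<Sigma> t + \<Sigma> t ** transpose (A + B ** K t) + M t + (2 * \<nu> t) *\<^sub>R \<Sigma> t)
        (at t within {0..1})"
    proof (rule has_vector_derivative_eq_rhs)
      have "A ** \<Phi> t ** S t ** transpose (\<Phi> t) = A ** \<Sigma> t"
        "\<Phi> t ** S t ** transpose (A ** \<Phi> t) = \<Sigma> t ** transpose A"
        by (simp_all add: \<Sigma>_def matrix_transpose_mul matrix_mul_assoc)
      then show "(\<Phi> t ** S t) ** transpose (A ** \<Phi> t + \<nu> t *\<^sub>R \<Phi> t)
        + (\<Phi> t ** (\<Psi> t ** M t ** transpose (\<Psi> t) + (\<Psi> t ** B) ** V t + transpose ((\<Psi> t ** B) ** V t))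
          + (A ** \<Phi> t + \<nu> t *\<^sub>R \<Phi> t) ** S t) ** transpose (\<Phi> t)
        = (A + B ** K t) ** \<Sigma> t + \<Sigma> t ** transpose (A + B ** K t) + M t + (2 * \<nu> t) *\<^sub>R \<Sigma> t"
        by (simp only: matrix_mult_linear_simps transpose_linear_simps B_left B_right conj_inverse
            \<Sigma>_def[symmetric] mult_2 scaleR_add_left) simp
    qed
  qed
  show ?thesis
  proof (intro exI conjI allI impI)
    show "continuous_on {0..1} K" "solves_covariance_ode A B K M \<nu> \<Sigma>" "\<Sigma> 0 = \<Sigma>\<^sub>0"
      by (rule contK solves \<Sigma>_0)+
    fix X assume X: "solves_covariance_ode A B K M \<nu> X \<and> X 0 = \<Sigma>\<^sub>0"
    have "X t = \<Sigma> t" if "t \<in> {0..1}" for t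
      using covariance_ode_unique[OF contK cont\<nu> _ solves _ that] X \<Sigma>_0 by auto
    then show "\<forall>t\<in>{0..1}. 0 \<prec>\<^sub>L X t" "X 1 = \<Sigma>\<^sub>1"
      using \<Sigma>_pos \<Sigma>_1 by auto
  qed
qed

end
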